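(* Let $G\le\mathrm{Sym}(m)$ and $H\le\mathrm{Sym}(n)$, each with its natural action, have the EKR property. Then the wreath product $G\wr H$, acting on $\Omega=[m]\times[n]$ by $(x,j)^{(g_1,\dots,g_n,h)}=(g_j(x),h(j))$, has the EKR property.
   Context: The wreath product $G\wr H$ has underlying set $G^n\times H$ with multiplication $(g_1,\dots,g_n,h)\cdot(g'_1,\dots,g'_n,h')=(g_1g'_{h(1)},\dots,g_ng'_{h(n)},hh')$; the displayed formula defines an action on $[m]\times[n]$. For a group $G$ acting faithfully on a finite set $\Omega$: $\pi,\sigma$ intersect if $\pi\sigma^{-1}$ fixes a point of $\Omega$; a subset is intersecting if every pair of its elements intersect; the group has the EKR property if every intersecting subset has size at most the size of the largest point-stabilizer. *)

theory Defs
  imports "HOL-Algebra.Algebra"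
begin

text \<open>
  All actions are right actions, so products are read from left to right: \<open>x\<close> is sent by a
  product of \<open>g\<close> and \<open>h\<close> to the image under \<open>h\<close> of the image of \<open>x\<close> under \<open>g\<close>. This is the
  convention under which the wreath multiplication below is associative and compatible with the
  action on pairs. The library's \<open>sym_group\<close> composes from right to left, so it is replaced by its
  opposite, which has the same carrier and the same subgroups.
\<close>

definition Sym :: "nat \<Rightarrow> (nat \<Rightarrow> nat) monoid" where
  "Sym n = (sym_group n)\<lparr>monoid.mult := (\<lambda>p q. q \<circ> p)\<rparr>"

locale faithful_right_action = group G for G :: "('a, 'c) monoid_scheme" (structure) +
  fixes \<Omega> :: "'b set" and \<phi> :: "'a \<Rightarrow> 'b \<Rightarrow> 'b"
  assumes finite_points: "finite \<Omega>"
    and act_closed: "\<lbrakk>g \<in> carrier G; x \<in> \<Omega>\<rbrakk> \<Longrightarrow> \<phi> g x \<in> \<Omega>"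
    and act_one: "x \<in> \<Omega> \<Longrightarrow> \<phi> \<one> x = x"
    and act_mult: "\<lbrakk>g \<in> carrier G; h \<in> carrier G; x \<in> \<Omega>\<rbrakk> \<Longrightarrow> \<phi> (g \<otimes> h) x = \<phi> h (\<phi> g x)"
    and faithful: "\<lbrakk>g \<in> carrier G; \<forall>x\<in>\<Omega>. \<phi> g x = x\<rbrakk> \<Longrightarrow> g = \<one>"

definition intersect ::
    "('a, 'c) monoid_scheme \<Rightarrow> 'b set \<Rightarrow> ('a \<Rightarrow> 'b \<Rightarrow> 'b) \<Rightarrow> 'a \<Rightarrow> 'a \<Rightarrow> bool" where
  "intersect G \<Omega> \<phi> \<pi> \<sigma> \<longleftrightarrow> (\<exists>\<omega>\<in>\<Omega>. \<phi> (\<pi> \<otimes>\<^bsub>G\<^esub> inv\<^bsub>G\<^esub> \<sigma>) \<omega> = \<omega>)"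

definition intersecting ::
    "('a, 'c) monoid_scheme \<Rightarrow> 'b set \<Rightarrow> ('a \<Rightarrow> 'b \<Rightarrow> 'b) \<Rightarrow> 'a set \<Rightarrow> bool" where
  "intersecting G \<Omega> \<phi> F \<longleftrightarrow>
     F \<subseteq> carrier G \<and> (\<forall>\<pi>\<in>F. \<forall>\<sigma>\<in>F. intersect G \<Omega> \<phi> \<pi> \<sigma>)"

text \<open>Only meaningful for a faithful right action on a nonempty finite set.\<close>

definition EKR_property ::
    "('a, 'c) monoid_scheme \<Rightarrow> 'b set \<Rightarrow> ('a \<Rightarrow> 'b \<Rightarrow> 'b) \<Rightarrow> bool" where
  "EKR_property G \<Omega> \<phi> \<longleftrightarrow>
     (\<forall>F. intersecting G \<Omega> \<phi> F \<longrightarrow> card F \<le> Max ((\<lambda>\<omega>. card (stabilizer G \<phi> \<omega>)) ` \<Omega>))"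

text \<open>Tuples indexed by \<open>{1..n}\<close> are extensional functions, hence determined by their entries.\<close>

definition wreath_product ::
    "nat \<Rightarrow> ('a, 'c) monoid_scheme \<Rightarrow> (nat \<Rightarrow> nat, 'd) monoid_scheme \<Rightarrow>
      ((nat \<Rightarrow> 'a) \<times> (nat \<Rightarrow> nat)) monoid" where
  "wreath_product n G H =
     \<lparr>carrier = ({1..n} \<rightarrow>\<^sub>E carrier G) \<times> carrier H,
      monoid.mult = (\<lambda>(g, h) (g', h'). (\<lambda>j\<in>{1..n}. g j \<otimes>\<^bsub>G\<^esub> g' (h j), h \<otimes>\<^bsub>H\<^esub> h')),
      one = (\<lambda>j\<in>{1..n}. \<one>\<^bsub>G\<^esub>, \<one>\<^bsub>H\<^esub>)\<rparr>"

definition wreath_action ::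
    "(nat \<Rightarrow> nat \<Rightarrow> nat) \<times> (nat \<Rightarrow> nat) \<Rightarrow> nat \<times> nat \<Rightarrow> nat \<times> nat" where
  "wreath_action = (\<lambda>(g, h) (x, j). (g j x, h j))"

lemma carrier_Sym [simp]: "carrier (Sym n) = {p. p permutes {1..n}}"
  and mult_Sym [simp]: "p \<otimes>\<^bsub>Sym n\<^esub> q = q \<circ> p"
  and one_Sym [simp]: "\<one>\<^bsub>Sym n\<^esub> = id"
  by (simp_all add: Sym_def sym_group_def)

lemma group_Sym: "group (Sym n)"
proof (rule groupI)
  fix p assume "p \<in> carrier (Sym n)"
  then show "\<exists>q\<in>carrier (Sym n). q \<otimes>\<^bsub>Sym n\<^esub> p = \<one>\<^bsub>Sym n\<^esub>"
    by (intro bexI[of _ "inv' p"]) (auto simp: permutes_inv permutes_inv_o)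
qed (auto simp: permutes_compose permutes_id comp_assoc)

lemma subgroup_Sym_iff: "subgroup K (Sym n) \<longleftrightarrow> subgroup K (sym_group n)"
proof -
  have inv_eq: "inv\<^bsub>Sym n\<^esub> p = inv\<^bsub>sym_group n\<^esub> p" if "p permutes {1..n}" for p
  proof -
    have "inv\<^bsub>Sym n\<^esub> p = inv' p"
      by (rule group.inv_equality[OF group_Sym]) (use that in \<open>auto simp: permutes_inv permutes_inv_o\<close>)
    moreover have "inv\<^bsub>sym_group n\<^esub> p = inv' p"
      by (rule group.inv_equality[OF sym_group_is_group])
        (use that in \<open>auto simp: sym_group_def permutes_inv permutes_inv_o\<close>)
    ultimately show ?thesis by simp
  qed
  show ?thesis
    by (auto simp: subgroup_def sym_group_mult sym_group_one sym_group_carrier subset_iff inv_eq)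
qed

lemma natural_action:
  assumes "subgroup K (Sym n)"
  shows "faithful_right_action ((Sym n)\<lparr>carrier := K\<rparr>) {1..n} (\<lambda>p. p)"
proof -
  have K: "p permutes {1..n}" if "p \<in> K" for p
    using subgroup.subset[OF assms] that by auto
  interpret group "(Sym n)\<lparr>carrier := K\<rparr>"
    by (rule group.subgroup_imp_group[OF group_Sym assms])
  show ?thesis
  proof (unfold_locales)
    fix p assume p: "p \<in> carrier ((Sym n)\<lparr>carrier := K\<rparr>)" and fixed: "\<forall>x\<in>{1..n}. p x = x"
    have "p x = x" for x
      using fixed permutes_not_in[OF K, of p x] p by (cases "x \<in> {1..n}") auto
    then show "p = \<one>\<^bsub>(Sym n)\<lparr>carrier := K\<rparr>\<^esub>" by (auto simp: fun_eq_iff)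
  qed (use K permutes_in_image in \<open>fastforce+\<close>)
qed

lemma group_wreath_product:
  assumes G: "group G" and H: "subgroup H (Sym n)"
  shows "group (wreath_product n G ((Sym n)\<lparr>carrier := H\<rparr>))" (is "group ?W")
proof -
  interpret G: group G by (rule G)
  interpret H: subgroup H "Sym n" by (rule H)
  have perm: "h permutes {1..n}" if "h \<in> H" for h
    using H.subset that by auto
  have in_range: "h j \<in> {1..n}" if "h \<in> H" "j \<in> {1..n}" for h j
    using permutes_in_image[OF perm[OF that(1)], of j] that(2) by simp
  show ?thesis
  proof (rule groupI)
    fix a b assume "a \<in> carrier ?W" "b \<in> carrier ?W"
    then show "a \<otimes>\<^bsub>?W\<^esub> b \<in> carrier ?W"
      using in_range H.m_closed
      by (auto simp: wreath_product_def PiE_iff simp del: atLeastAtMost_iff)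
  next
    show "\<one>\<^bsub>?W\<^esub> \<in> carrier ?W"
      using H.one_closed by (auto simp: wreath_product_def)
  next
    fix a b c assume "a \<in> carrier ?W" "b \<in> carrier ?W" "c \<in> carrier ?W"
    then show "a \<otimes>\<^bsub>?W\<^esub> b \<otimes>\<^bsub>?W\<^esub> c = a \<otimes>\<^bsub>?W\<^esub> (b \<otimes>\<^bsub>?W\<^esub> c)"
      using in_range
      by (auto simp: wreath_product_def PiE_iff comp_assoc G.m_assoc fun_eq_iff restrict_def
               simp del: atLeastAtMost_iff)
  next
    fix a assume "a \<in> carrier ?W"
    then show "\<one>\<^bsub>?W\<^esub> \<otimes>\<^bsub>?W\<^esub> a = a"
      by (auto simp: wreath_product_def PiE_iff fun_eq_iff restrict_def extensional_def
               simp del: atLeastAtMost_iff)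
  next
    fix a assume "a \<in> carrier ?W"
    then obtain g h where a: "a = (g, h)" and g: "g \<in> {1..n} \<rightarrow>\<^sub>E carrier G" and h: "h \<in> H"
      by (auto simp: wreath_product_def)
    have "inv\<^bsub>Sym n\<^esub> h = inv' h"
      by (rule group.inv_equality[OF group_Sym])
        (use perm[OF h] in \<open>auto simp: permutes_inv permutes_inv_o\<close>)
    with H.m_inv_closed[OF h] have h': "inv' h \<in> H" by simp
    define g' where "g' = (\<lambda>j\<in>{1..n}. inv\<^bsub>G\<^esub> (g (inv' h j)))"
    have mem: "(g', inv' h) \<in> carrier ?W"
      using g h' in_range[OF h']
      by (auto simp: wreath_product_def g'_def PiE_iff simp del: atLeastAtMost_iff)
    have "(g', inv' h) \<otimes>\<^bsub>?W\<^esub> a = \<one>\<^bsub>?W\<^esub>"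
      using g in_range[OF h'] permutes_inv_o(1)[OF perm[OF h]]
      by (auto simp: a wreath_product_def g'_def PiE_iff fun_eq_iff restrict_def
               simp del: atLeastAtMost_iff)
    with mem show "\<exists>b\<in>carrier ?W. b \<otimes>\<^bsub>?W\<^esub> a = \<one>\<^bsub>?W\<^esub>" by blast
  qed
qed

lemma wreath_faithful_action:
  assumes G: "subgroup G (Sym m)" and H: "subgroup H (Sym n)" and "m \<ge> 1"
  shows "faithful_right_action
           (wreath_product n ((Sym m)\<lparr>carrier := G\<rparr>) ((Sym n)\<lparr>carrier := H\<rparr>))
           ({1..m} \<times> {1..n}) wreath_action" (is "faithful_right_action ?W _ _")
proof -
  interpret W: group ?W
    by (rule group_wreath_product[OF group.subgroup_imp_group[OF group_Sym G] H])
  have permG: "g permutes {1..m}" if "g \<in> G" for g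
    using subgroup.subset[OF G] that by auto
  have permH: "h permutes {1..n}" if "h \<in> H" for h
    using subgroup.subset[OF H] that by auto
  have inG: "g x \<in> {1..m}" if "g \<in> G" "x \<in> {1..m}" for g x
    using permutes_in_image[OF permG[OF that(1)], of x] that(2) by simp
  have inH: "h j \<in> {1..n}" if "h \<in> H" "j \<in> {1..n}" for h j
    using permutes_in_image[OF permH[OF that(1)], of j] that(2) by simp
  show ?thesis
  proof (unfold_locales)
    fix a assume "a \<in> carrier ?W" and fixed: "\<forall>p\<in>{1..m} \<times> {1..n}. wreath_action a p = p"
    then obtain g h where a: "a = (g, h)" and g: "g \<in> {1..n} \<rightarrow>\<^sub>E G" and h: "h \<in> H"
      by (auto simp: wreath_product_def)
    have fix_gh: "g j x = x \<and> h j = j" if "x \<in> {1..m}" "j \<in> {1..n}" for x j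
      using fixed that by (auto simp: a wreath_action_def)
    have "h j = j" for j
      using fix_gh[of 1 j] \<open>m \<ge> 1\<close> permutes_not_in[OF permH[OF h], of j]
      by (cases "j \<in> {1..n}") auto
    moreover have "g j x = x" if j: "j \<in> {1..n}" for j x
      using fix_gh[OF _ j, of x] permutes_not_in[OF permG, of "g j" x] g j
      by (cases "x \<in> {1..m}") (auto simp: PiE_iff)
    ultimately show "a = \<one>\<^bsub>?W\<^esub>"
      using g by (auto simp: a wreath_product_def fun_eq_iff PiE_iff extensional_def restrict_def)
  qed (use inG inH in \<open>auto simp: wreath_product_def wreath_action_def PiE_iff
         simp del: atLeastAtMost_iff\<close>)
qed

end

theory Submission
  imports Defs
begin

text \<open>
  Two elements of a permutation group intersect iff they agree at a point. Fix a tuple \<open>k\<close> in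
  \<open>G^n\<close> and consider the pairs \<open>(g, h)\<close> for which \<open>(g k\<^sub>1, \<dots>, g k\<^sub>n, h)\<close> lies in an intersecting
  family \<open>F\<close> of the wreath product. If two such elements of \<open>F\<close> agree at \<open>(x, j)\<close>, then their
  \<open>h\<close>-parts agree at \<open>j\<close> and, cancelling \<open>k\<^sub>j\<close>, their \<open>g\<close>-parts agree at \<open>x\<close>. So these pairs lie in
  the product of an intersecting family of \<open>G\<close> and one of \<open>H\<close>, and their number is at most the
  product \<open>a b\<close> of the largest stabilizer sizes. Each element of \<open>F\<close> arises from exactly \<open>|G|\<close>
  choices of \<open>(k, g)\<close>; averaging over \<open>k\<close> therefore gives \<open>|F| |G| \<le> |G|^n a b\<close>, and
  \<open>|G|^(n-1) a b\<close> is the size of a point stabilizer of the wreath product.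
\<close>

context faithful_right_action
begin

text \<open>In a right action \<open>p \<otimes> inv q\<close> applies \<open>p\<close> first, so a
  point it fixes is itself a point where \<open>p\<close> and \<open>q\<close> agree.\<close>

lemma intersect_iff_agree:
  assumes p: "p \<in> carrier G" and q: "q \<in> carrier G"
  shows "intersect G \<Omega> \<phi> p q \<longleftrightarrow> (\<exists>\<omega>\<in>\<Omega>. \<phi> p \<omega> = \<phi> q \<omega>)"
proof -
  have "\<phi> (p \<otimes> inv q) \<omega> = \<omega> \<longleftrightarrow> \<phi> p \<omega> = \<phi> q \<omega>" if \<omega>: "\<omega> \<in> \<Omega>" for \<omega>
  proof
    assume "\<phi> (p \<otimes> inv q) \<omega> = \<omega>"
    then have "\<phi> q \<omega> = \<phi> (p \<otimes> inv q \<otimes> q) \<omega>"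
      using act_mult[of "p \<otimes> inv q" q \<omega>] p q \<omega> by simp
    then show "\<phi> p \<omega> = \<phi> q \<omega>" using p q by (simp add: m_assoc)
  next
    assume "\<phi> p \<omega> = \<phi> q \<omega>"
    then have "\<phi> (p \<otimes> inv q) \<omega> = \<phi> (q \<otimes> inv q) \<omega>"
      using p q \<omega> by (simp only: act_mult inv_closed)
    then show "\<phi> (p \<otimes> inv q) \<omega> = \<omega>" using q \<omega> by (simp add: act_one)
  qed
  then show ?thesis by (auto simp: intersect_def)
qed

lemma intersecting_iff_agree:
  "intersecting G \<Omega> \<phi> F \<longleftrightarrow>
     F \<subseteq> carrier G \<and> (\<forall>p\<in>F. \<forall>q\<in>F. \<exists>\<omega>\<in>\<Omega>. \<phi> p \<omega> = \<phi> q \<omega>)"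
  using intersect_iff_agree unfolding intersecting_def by blast

end

lemma finite_subgroup_Sym:
  assumes "subgroup K (Sym n)"
  shows "finite K"
  using subgroup.subset[OF assms] finite_permutations[of "{1..n}"] by (auto intro: finite_subset)

lemma subgroup_Sym_permutes:
  assumes "subgroup K (Sym n)" and "p \<in> K"
  shows "p permutes {1..n}"
  using subgroup.subset[OF assms(1)] assms(2) by auto

lemma subgroup_Sym_comp:
  assumes "subgroup K (Sym n)" and "p \<in> K" and "q \<in> K"
  shows "p \<circ> q \<in> K"
  using subgroup.m_closed[OF assms(1,3,2)] by simp

lemma subgroup_Sym_inv:
  assumes "subgroup K (Sym n)" and "p \<in> K"
  shows "inv' p \<in> K"
proof -
  have "inv\<^bsub>Sym n\<^esub> p = inv' p"
    by (rule group.inv_equality[OF group_Sym])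
      (use subgroup_Sym_permutes[OF assms] in \<open>auto simp: permutes_inv permutes_inv_o\<close>)
  with subgroup.m_inv_closed[OF assms] show ?thesis by simp
qed

lemma intersecting_Sym_iff:
  assumes "subgroup K (Sym n)"
  shows "intersecting ((Sym n)\<lparr>carrier := K\<rparr>) {1..n} (\<lambda>p. p) F \<longleftrightarrow>
           F \<subseteq> K \<and> (\<forall>p\<in>F. \<forall>q\<in>F. \<exists>x\<in>{1..n}. p x = q x)"
  using faithful_right_action.intersecting_iff_agree[OF natural_action[OF assms]] by simp

text \<open>The bounds \<open>a\<close> and \<open>b\<close> are arbitrary, which separates the
  averaging from the choice of stabilizers. The factor \<open>card G\<close> stays on the left so
  that no division occurs.\<close>

lemma card_intersecting_wreath_le:
  assumes G: "subgroup G (Sym m)" and H: "subgroup H (Sym n)" and m: "m \<ge> 1"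
    and a: "\<And>A. intersecting ((Sym m)\<lparr>carrier := G\<rparr>) {1..m} (\<lambda>g. g) A \<Longrightarrow> card A \<le> a"
    and b: "\<And>B. intersecting ((Sym n)\<lparr>carrier := H\<rparr>) {1..n} (\<lambda>h. h) B \<Longrightarrow> card B \<le> b"
    and F: "intersecting (wreath_product n ((Sym m)\<lparr>carrier := G\<rparr>) ((Sym n)\<lparr>carrier := H\<rparr>))
              ({1..m} \<times> {1..n}) wreath_action F"
  shows "card F * card G \<le> card G ^ n * (a * b)"
proof -
  have F_agree: "\<exists>j\<in>{1..n}. \<exists>x\<in>{1..m}. f j x = f' j x \<and> h j = h' j"
    if "(f, h) \<in> F" "(f', h') \<in> F" for f h f' h'
    using F that
    unfolding faithful_right_action.intersecting_iff_agree[OF wreath_faithful_action[OF G H m]]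
    by (fastforce simp: wreath_product_def wreath_action_def)
  have F_sub: "F \<subseteq> ({1..n} \<rightarrow>\<^sub>E G) \<times> H"
    using F by (auto simp: intersecting_def wreath_product_def)
  define K where "K = ({1..n} \<rightarrow>\<^sub>E G)"
  \<comment> \<open>Since products read left to right, \<open>k j \<circ> g\<close> is the product
    of \<open>g\<close> and \<open>k j\<close>: \<open>g\<close> acts first, and injectivity of
    \<open>k j\<close> can cancel it.\<close>
  define S where "S k = {(g, h) \<in> G \<times> H. (\<lambda>j\<in>{1..n}. k j \<circ> g, h) \<in> F}" for k
  note fin = finite_subgroup_Sym[OF G] finite_subgroup_Sym[OF H]
  have fin_K: "finite K" unfolding K_def using fin by (simp add: finite_PiE)
  have fin_S: "finite (S k)" for k
    by (rule finite_subset[of _ "G \<times> H"]) (use fin in \<open>auto simp: S_def\<close>)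
  have card_S: "card (S k) \<le> a * b" if k: "k \<in> K" for k
  proof -
    have agree: "(\<exists>x\<in>{1..m}. fst s x = fst t x) \<and> (\<exists>j\<in>{1..n}. snd s j = snd t j)"
      if st: "s \<in> S k" "t \<in> S k" for s t
    proof -
      obtain g h g' h' where gh: "s = (g, h)" "t = (g', h')" by fastforce
      obtain j x where j: "j \<in> {1..n}" and x: "x \<in> {1..m}"
        and eq: "k j (g x) = k j (g' x)" "h j = h' j"
        using F_agree[of "\<lambda>j\<in>{1..n}. k j \<circ> g" h "\<lambda>j\<in>{1..n}. k j \<circ> g'" h'] st gh
        by (auto simp: S_def)
      have "k j \<in> G" using k j by (auto simp: K_def)
      then have "inj (k j)" using subgroup_Sym_permutes[OF G] permutes_inj by blast
      with eq(1) have "g x = g' x" by (simp add: inj_eq)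
      with j x eq(2) gh show ?thesis by auto
    qed
    have "card (fst ` S k) \<le> a"
    proof (rule a, unfold intersecting_Sym_iff[OF G], intro conjI)
      show "fst ` S k \<subseteq> G" by (auto simp: S_def)
      show "\<forall>p\<in>fst ` S k. \<forall>q\<in>fst ` S k. \<exists>x\<in>{1..m}. p x = q x"
        using agree by blast
    qed
    moreover have "card (snd ` S k) \<le> b"
    proof (rule b, unfold intersecting_Sym_iff[OF H], intro conjI)
      show "snd ` S k \<subseteq> H" by (auto simp: S_def)
      show "\<forall>p\<in>snd ` S k. \<forall>q\<in>snd ` S k. \<exists>x\<in>{1..n}. p x = q x"
        using agree by blast
    qed
    \<comment> \<open>\<open>S k\<close> may be smaller than the product of its projections; both
      projections are intersecting, which bounds that product.\<close>
    moreover have "card (S k) \<le> card (fst ` S k \<times> snd ` S k)"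
      using fin_S by (intro card_mono subset_fst_snd) simp
    ultimately show ?thesis
      unfolding card_cartesian_product by (meson mult_le_mono order_trans)
  qed
  let ?\<psi> = "\<lambda>(k, g, h). ((\<lambda>j\<in>{1..n}. k j \<circ> g, h), g)"
  have "F \<times> G \<subseteq> ?\<psi> ` (SIGMA k:K. S k)"
  proof (clarify)
    fix f h g assume fh: "(f, h) \<in> F" and g: "g \<in> G"
    \<comment> \<open>This tuple solves \<open>k j \<circ> g = f j\<close> in every coordinate, so
      each choice of \<open>g\<close> places \<open>(f, h)\<close> in the count for some
      \<open>k\<close>.\<close>
    define k where "k = (\<lambda>j\<in>{1..n}. f j \<circ> inv' g)"
    have f: "f \<in> {1..n} \<rightarrow>\<^sub>E G" and h: "h \<in> H" using F_sub fh by auto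
    have k: "k \<in> K"
      using f subgroup_Sym_comp[OF G _ subgroup_Sym_inv[OF G g]] by (auto simp: K_def k_def PiE_iff)
    have kf: "(\<lambda>j\<in>{1..n}. k j \<circ> g) = f"
      using f permutes_inv_o(2)[OF subgroup_Sym_permutes[OF G g]]
      by (auto simp: k_def PiE_iff fun_eq_iff extensional_def)
    then have "(k, g, h) \<in> (SIGMA k:K. S k)" using k g h fh by (simp add: S_def)
    moreover have "((f, h), g) = ?\<psi> (k, g, h)" using kf by simp
    ultimately show "((f, h), g) \<in> ?\<psi> ` (SIGMA k:K. S k)" by (intro rev_image_eqI)
  qed
  then have "card (F \<times> G) \<le> card (SIGMA k:K. S k)"
    using fin_K fin_S by (intro surj_card_le) auto
  also have "\<dots> = (\<Sum>k\<in>K. card (S k))"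
    using fin_K fin_S by (intro card_SigmaI) auto
  also have "\<dots> \<le> card K * (a * b)"
    using sum_bounded_above[of K "\<lambda>k. card (S k)" "a * b"] card_S by simp
  also have "card K = card G ^ n"
    by (simp add: K_def card_PiE)
  finally show ?thesis by (simp add: card_cartesian_product)
qed

text \<open>Fixing \<open>(x, j)\<close> constrains only the top permutation and the coordinate at
  \<open>j\<close>; the other \<open>n - 1\<close> coordinates range freely over
  \<open>G\<close>.\<close>

lemma card_stabilizer_wreath:
  assumes "finite G" and j: "j \<in> {1..n}"
  shows "card (stabilizer (wreath_product n ((Sym m)\<lparr>carrier := G\<rparr>) ((Sym n)\<lparr>carrier := H\<rparr>))
                 wreath_action (x, j)) =
         card G ^ (n - 1) * (card (stabilizer ((Sym m)\<lparr>carrier := G\<rparr>) (\<lambda>g. g) x) *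
           card (stabilizer ((Sym n)\<lparr>carrier := H\<rparr>) (\<lambda>h. h) j))"
    (is "card ?S = _ * (card ?Gx * card ?Hj)")
proof -
  let ?B = "\<lambda>i. if i = j then ?Gx else G"
  have "?S = ({1..n} \<rightarrow>\<^sub>E G) \<times> H \<inter> {(f, h). f j x = x \<and> h j = j}"
    by (auto simp: stabilizer_def wreath_product_def wreath_action_def)
  also have "\<dots> = (\<Pi>\<^sub>E i\<in>{1..n}. ?B i) \<times> ?Hj"
    using j by (auto simp: stabilizer_def PiE_iff split: if_splits)
  finally have "card ?S = (\<Prod>i\<in>{1..n}. card (?B i)) * card ?Hj"
    by (simp add: card_cartesian_product card_PiE)
  also have "(\<Prod>i\<in>{1..n}. card (?B i)) = card ?Gx * (\<Prod>i\<in>{1..n} - {j}. card (?B i))"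
    using j by (subst prod.remove[of _ j]) auto
  also have "(\<Prod>i\<in>{1..n} - {j}. card (?B i)) = (\<Prod>i\<in>{1..n} - {j}. card G)"
    by (rule prod.cong) auto
  also have "\<dots> = card G ^ (n - 1)" using j by simp
  finally show ?thesis by simp
qed

theorem theorem5p22:
  fixes m n :: nat and G H :: "(nat \<Rightarrow> nat) set"
  assumes "subgroup G (Sym m)" and "subgroup H (Sym n)"
    and "EKR_property ((Sym m)\<lparr>carrier := G\<rparr>) {1..m} (\<lambda>g. g)"
    and "EKR_property ((Sym n)\<lparr>carrier := H\<rparr>) {1..n} (\<lambda>h. h)"
  shows "EKR_property (wreath_product n ((Sym m)\<lparr>carrier := G\<rparr>) ((Sym n)\<lparr>carrier := H\<rparr>))
           ({1..m} \<times> {1..n}) wreath_action"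
  (is "EKR_property ?W ?\<Omega> _")
  unfolding EKR_property_def
proof (intro allI impI)
  fix F assume F: "intersecting ?W ?\<Omega> wreath_action F"
  let ?stab = "\<lambda>\<omega>. card (stabilizer ?W wreath_action \<omega>)"
  show "card F \<le> Max (?stab ` ?\<Omega>)"
  proof (cases "m \<ge> 1 \<and> n \<ge> 1")
    \<comment> \<open>Here \<open>Max\<close> is taken over the empty set and has no known value.
      With no points, no element intersects even itself, so \<open>F\<close> is empty and the bound
      is trivial.\<close>
    case False
    then have "?\<Omega> = {}" by auto
    then have "F = {}" using F by (auto simp: intersecting_def intersect_def)
    then show ?thesis by simp
  next
    case True
    let ?stabG = "\<lambda>x. card (stabilizer ((Sym m)\<lparr>carrier := G\<rparr>) (\<lambda>g. g) x)"
    let ?stabH = "\<lambda>j. card (stabilizer ((Sym n)\<lparr>carrier := H\<rparr>) (\<lambda>h. h) j)"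
    have "Max (?stabG ` {1..m}) \<in> ?stabG ` {1..m}" "Max (?stabH ` {1..n}) \<in> ?stabH ` {1..n}"
      using True by (intro Max_in; simp)+
    \<comment> \<open>Points with the largest stabilizers in the two factors; the stabilizer of
      \<open>(x, j)\<close> will dominate \<open>card F\<close>.\<close>
    then obtain x j where x: "x \<in> {1..m}" "?stabG x = Max (?stabG ` {1..m})"
      and j: "j \<in> {1..n}" "?stabH j = Max (?stabH ` {1..n})"
      by (metis (no_types, lifting) imageE)
    have finG: "finite G" by (rule finite_subgroup_Sym[OF assms(1)])
    then have pos: "card G > 0"
      using subgroup.one_closed[OF assms(1)] by (auto simp: card_gt_0_iff)
    have "card F * card G \<le> card G ^ n * (?stabG x * ?stabH j)"
      using card_intersecting_wreath_le[OF assms(1,2) _ _ _ F] assms(3,4) True x(2) j(2)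
      unfolding EKR_property_def by simp
    \<comment> \<open>As \<open>n \<ge> 1\<close>, one factor \<open>card G\<close> splits off and
      cancels the one on the left.\<close>
    also have "card G ^ n = card G ^ (n - 1) * card G"
      using True by (cases n) simp_all
    finally have "card F * card G \<le> ?stab (x, j) * card G"
      by (simp add: card_stabilizer_wreath[OF finG j(1)] mult_ac)
    then have "card F \<le> ?stab (x, j)" using pos by simp
    also have "\<dots> \<le> Max (?stab ` ?\<Omega>)"
      using x(1) j(1) by (intro Max_ge) auto
    finally show ?thesis .
  qed
qed

end
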